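(* Let $N>0$ be an integer. There is no integer $C$ such that for every integer $n\ge 0$ there exists an integer index $j\ge 0$ (depending on $n$ and $N$) with $$\sum_{i=0}^{4N-1} F(n+i) = C\cdot F(j).$$
   Context: The Fibonacci numbers are defined by $F(0)=0$, $F(1)=1$, $F(n)=F(n-1)+F(n-2)$ for $n\ge 2$. *)

theory Defs
  imports "HOL-Number_Theory.Fib"
begin

end

theory Submission imports Defs "HOL-Computational_Algebra.Primes"
begin

text \<open>
  Let $S(n)$ be the sum of the statement and $Q(x,y) = y^2 - xy - x^2$. A step
  $(x,y) \mapsto (y,x+y)$ of the Fibonacci recurrence only flips the sign of $Q$. Hence
  $Q = \pm 1$ at consecutive Fibonacci numbers, while $Q(S(n),S(n+1)) = \pm 5 F(2N)^2$.
  If $S(n) = C\,F(j_n)$ for all $n$, then $F(j_2) < F(j_3) < 2F(j_2)$ forces $j_3 = j_2 + 1$,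
  so $C^2 = \pm 5 F(2N)^2$, contradicting the irrationality of $\sqrt 5$.
\<close>

text \<open>The norm of y - x phi in Z[phi], phi the golden ratio. A Fibonacci step multiplies this
  element by 1 - phi, a unit of norm -1.\<close>

definition fib_form :: "int \<Rightarrow> int \<Rightarrow> int" where
  "fib_form x y = y\<^sup>2 - x * y - x\<^sup>2"

lemma fib_form_step: "fib_form y (x + y) = - fib_form x y"
  by (simp add: fib_form_def power2_eq_square algebra_simps)

lemma fib_form_mult: "fib_form (c * x) (c * y) = c\<^sup>2 * fib_form x y"
  by (simp add: fib_form_def power2_eq_square algebra_simps)

text \<open>Cassini's identity in terms of the form.\<close>

lemma fib_form_fib: "fib_form (int (fib n)) (int (fib (Suc n))) = (-1) ^ n"
proof (induction n)
  case (Suc n)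
  then show ?case
    using fib_form_step[of "int (fib (Suc n))" "int (fib n)"] by (simp add: add.commute)
qed (simp add: fib_form_def)

text \<open>Telescoping, as F(m) = F(m+2) - F(m+1).\<close>

lemma sum_fib_shift: "(\<Sum>i<k. int (fib (n + i))) = int (fib (n + k + 1)) - int (fib (n + 1))"
  by (induction k) auto

lemma fib_form_sum_fib:
  fixes N :: nat
  defines "S \<equiv> \<lambda>n. \<Sum>i<4 * N. int (fib (n + i))"
  shows "fib_form (S 0) (S 1) = 5 * (int (fib (2 * N)))\<^sup>2"
proof -
  define u v where "u = int (fib (2 * N))" and "v = int (fib (Suc (2 * N)))"
  define p q where "p = int (fib (4 * N))" and "q = int (fib (Suc (4 * N)))"
  have uv: "v\<^sup>2 - u * v - u\<^sup>2 = 1"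
    using fib_form_fib[of "2 * N"] by (simp add: fib_form_def u_def v_def)
  have pq: "q\<^sup>2 - p * q - p\<^sup>2 = 1"
    using fib_form_fib[of "4 * N"] by (simp add: fib_form_def p_def q_def)
  have q: "q = u\<^sup>2 + v\<^sup>2"
    using fib_add[of "2 * N" "2 * N"]
    by (simp add: q_def u_def v_def power2_eq_square flip: mult_2)
  \<comment> \<open>F(4N) is obtained as F(4N+2) - F(4N+1), which avoids the index 2N - 1 in the
    addition formula.\<close>
  have "fib (Suc (Suc (2 * N) + 2 * N)) =
      fib (Suc (2 * N)) * fib (Suc (Suc (2 * N))) + fib (2 * N) * fib (Suc (2 * N))"
    by (rule fib_add)
  moreover have "Suc (Suc (2 * N) + 2 * N) = Suc (Suc (4 * N))" by simp
  ultimately have "fib (Suc (4 * N)) + fib (4 * N) =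
      fib (Suc (2 * N)) * (fib (Suc (2 * N)) + fib (2 * N)) + fib (2 * N) * fib (Suc (2 * N))"
    by (metis fib.simps(3))
  then have "q + p = v * (v + u) + u * v"
    unfolding p_def q_def u_def v_def by (metis of_nat_add of_nat_mult)
  then have p: "p = 2 * u * v - u\<^sup>2"
    using q by (simp add: power2_eq_square algebra_simps)
  have S: "S 0 = q - 1" "S 1 = q + p - 1"
    by (simp_all add: S_def sum_fib_shift p_def q_def)
  \<comment> \<open>The shift by F(1) = F(2) = 1 adds linear terms to -Q(p,q); the doubling formulas
    make them quadratic in u and v.\<close>
  have "fib_form (S 0) (S 1) = 2 * q - p - 1 - (q\<^sup>2 - p * q - p\<^sup>2)"
    unfolding S by (simp add: fib_form_def power2_eq_square algebra_simps)
  also have "\<dots> = 5 * u\<^sup>2 + 2 * (v\<^sup>2 - u * v - u\<^sup>2) - 2"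
    unfolding pq unfolding p q by (simp add: algebra_simps)
  finally show ?thesis
    unfolding uv unfolding u_def by simp
qed

text \<open>Monotonicity excludes b \<le> a, and F(a+2) = F(a+1) + F(a) \<ge> 2 F(a) excludes b
  \<ge> a + 2.\<close>

lemma fib_eq_Suc_index:
  assumes "fib a < fib b" "fib b < 2 * fib a"
  shows "b = Suc a"
proof (rule ccontr)
  assume "b \<noteq> Suc a"
  then consider "b \<le> a" | "Suc (Suc a) \<le> b" by linarith
  then show False
  proof cases
    case 1
    then show False using fib_mono[of b a] assms by simp
  next
    case 2
    then show False
      using fib_mono[of "Suc (Suc a)" b] fib_Suc_mono[of a] assms by simp
  qed
qed

text \<open>The multiplicity of p is even in a nonzero square, but odd in p times one.\<close>

lemma square_neq_prime_mult_square:
  fixes p x y :: int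
  assumes "prime p" "y \<noteq> 0"
  shows "x\<^sup>2 \<noteq> p * y\<^sup>2"
proof
  assume eq: "x\<^sup>2 = p * y\<^sup>2"
  have p: "prime_elem p" "p \<noteq> 0" using assms(1) by auto
  with eq assms(2) have "x \<noteq> 0" by auto
  have "2 * multiplicity p x = multiplicity p (x\<^sup>2)"
    using p \<open>x \<noteq> 0\<close> by (simp add: prime_elem_multiplicity_power_distrib)
  also have "\<dots> = Suc (2 * multiplicity p y)"
    using p assms(2)
    by (simp add: eq prime_elem_multiplicity_mult_distrib prime_elem_multiplicity_power_distrib)
  finally show False by presburger
qed

theorem theorem5p2:
  fixes N :: nat
  assumes "N > 0"
  shows "\<not> (\<exists>C :: int. \<forall>n :: nat. \<exists>j :: nat.
           (\<Sum>i = 0..4 * N - 1. int (fib (n + i))) = C * int (fib j))"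
proof
  define S where "S = (\<lambda>n. \<Sum>i<4 * N. int (fib (n + i)))"
  \<comment> \<open>Subtraction is truncated, so this fails for N = 0.\<close>
  have range: "{0..4 * N - 1} = {..<4 * N}" using assms by auto
  assume "\<exists>C :: int. \<forall>n :: nat. \<exists>j :: nat.
           (\<Sum>i = 0..4 * N - 1. int (fib (n + i))) = C * int (fib j)"
  then obtain C j where j: "\<And>n. S n = C * int (fib (j n))"
    unfolding range S_def by metis
  have rec: "S (Suc (Suc n)) = S n + S (Suc n)" for n
    by (simp add: S_def add.commute flip: sum.distrib)
  have pos: "S n > 0" if "n > 0" for n
    unfolding S_def using assms that by (intro sum_pos) (auto simp: fib_neq_0_nat lessThan_empty_iff)
  \<comment> \<open>Here the first summand is F(0) = 0; the summand F(1) = 1 gives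
    positivity.\<close>
  have "S 0 > 0"
    using fib_mono[of 2 "4 * N"] assms member_le_sum[of 1 "{..<4 * N}" "\<lambda>i. int (fib (0 + i))"]
    by (simp add: S_def)
  have "C > 0"
    using pos[of 1] j[of 1] by (simp add: zero_less_mult_iff)
  \<comment> \<open>From index 2 on, the recurrence and positivity suffice: S(3) = S(2) + S(1), and
    S(1) < S(2) since S(0) > 0.\<close>
  have "S 2 < S 3" "S 3 < 2 * S 2"
    using rec[of 0] rec[of 1] pos[of 1] \<open>S 0 > 0\<close> by (simp_all add: eval_nat_numeral)
  then have "fib (j 2) < fib (j 3)" "fib (j 3) < 2 * fib (j 2)"
    using \<open>C > 0\<close> by (auto simp: j mult.left_commute[of 2 C])
  then have "j 3 = Suc (j 2)"
    by (rule fib_eq_Suc_index)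
  then have "C\<^sup>2 * (-1) ^ j 2 = fib_form (S 2) (S 3)"
    by (simp add: j fib_form_mult fib_form_fib del: fib.simps)
  \<comment> \<open>Two steps of the recurrence, so the signs cancel.\<close>
  also have "\<dots> = fib_form (S 0) (S 1)"
    using rec[of 0] rec[of 1] fib_form_step[of "S 1" "S 0"] fib_form_step[of "S 2" "S 1"]
    by (simp add: eval_nat_numeral)
  also have "\<dots> = 5 * (int (fib (2 * N)))\<^sup>2"
    unfolding S_def by (rule fib_form_sum_fib)
  finally have eq: "C\<^sup>2 * (-1) ^ j 2 = 5 * (int (fib (2 * N)))\<^sup>2" .
  have F: "int (fib (2 * N)) \<noteq> 0"
    using fib_neq_0_nat[of "2 * N"] assms by simp
  show False
  proof (cases "even (j 2)")
    case True
    then show False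
      using eq square_neq_prime_mult_square[of 5 "int (fib (2 * N))" C] F by simp
  next
    case False
    then have "- C\<^sup>2 = 5 * (int (fib (2 * N)))\<^sup>2" using eq by simp
    moreover have "(int (fib (2 * N)))\<^sup>2 > 0" using F by simp
    ultimately show False using zero_le_power2[of C] by linarith
  qed
qed

end
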